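(* Let $J_1,J_2>0$, let $N$ be a positive integer, and let $k\ge 2$ be an integer. Consider the antiferromagnetic J$_1$-J$_2$ Hamiltonian on $2N$ qubits with periodic boundary conditions, $$H_{\mathrm{J1\text{-}J2}} = J_1\sum_{l=1}^{2N}\vec\sigma^{\,l}\cdot\vec\sigma^{\,l+1}+J_2\sum_{l=1}^{2N}\vec\sigma^{\,l}\cdot\vec\sigma^{\,l+2},$$ with site indices taken modulo $2N$. If a $2N$-qubit state $\rho$ satisfies $$\operatorname{Tr}[\rho H_{\mathrm{J1\text{-}J2}}] < -2N(J_1+J_2)\left(1+\frac{2}{k}\right),$$ then $\rho$ is $k$-unextendible.
   Context: $\vec\sigma^{\,l}=(\sigma_1^l,\sigma_2^l,\sigma_3^l)$ are the Pauli matrices acting on the $l$-th tensor factor of $(\mathbb{C}^2)^{\otimes 2N}$, and $\vec\sigma^{\,l}\cdot\vec\sigma^{\,m}=\sum_{i=1}^3\sigma_i^l\sigma_i^m$. $\mathcal{D}(\mathcal{H})$ is the set of density operators on $\mathcal{H}$. Bipartite $k$-extendibility: for an integer $k\ge 2$, a bipartite state $\rho_{AB}\in\mathcal{D}(\mathcal{H}_A\otimes\mathcal{H}_B)$ is $k$-extendible with respect to the subsystem $B$ if there is a state $\tilde\rho_{AB_1\cdots B_k}\in\mathcal{D}(\mathcal{H}_A\otimes\mathcal{H}_{B_1}\otimes\cdots\otimes\mathcal{H}_{B_k})$, with $\mathcal{H}_{B_i}\simeq\mathcal{H}_B$ for all $i$, such that for every $i\in\{1,\dots,k\}$ the marginal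 of $\tilde\rho$ on $AB_i$ (partial trace over all $B_j$, $j\ne i$) equals $\rho_{AB}$. Multipartite $k$-extendibility: a multipartite state is called $k$-extendible if it is $k$-extendible with respect to each of its subsystems (for each elementary subsystem, take $B$ to be that subsystem and $A$ to be all the remaining subsystems together). Otherwise it is called $k$-unextendible. Here the subsystems are the $2N$ individual qubits (sites). *)

theory Defs
  imports Complex_Main "Jordan_Normal_Form.Schur_Decomposition"
begin

definition mat_trace :: "'a::comm_monoid_add mat \<Rightarrow> 'a" where
  "mat_trace A = (\<Sum>i<dim_row A. A $$ (i, i))"

definition mat_sum :: "nat \<Rightarrow> ('b \<Rightarrow> 'a::comm_monoid_add mat) \<Rightarrow> 'b set \<Rightarrow> 'a mat" where
  "mat_sum d F S = mat d d (\<lambda>ij. \<Sum>x\<in>S. F x $$ ij)"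

(* The Hilbert space is C^d with its standard orthonormal basis; (\<rho> v) \<bullet>c v is <v, \<rho> v>. *)
definition density_operator :: "nat \<Rightarrow> complex mat \<Rightarrow> bool" where
  "density_operator d \<rho> \<longleftrightarrow>
     \<rho> \<in> carrier_mat d d \<and>
     mat_adjoint \<rho> = \<rho> \<and>
     (\<forall>v\<in>carrier_vec d. 0 \<le> Re ((\<rho> *\<^sub>v v) \<bullet>c v)) \<and>
     mat_trace \<rho> = 1"

(* A list ds of local dimensions stands for the tensor product of the spaces C^(ds ! 0),
   C^(ds ! 1), ..., whose dimension is prod_list ds. Its product basis is numbered in the order
   of the Kronecker product: the basis vector e_(x 0) (x) e_(x 1) (x) ... has the number with
   mixed-radix digits x 0, x 1, ... (most significant first), and digit ds i l recovers x l from
   the number i. In particular, merging adjacent factors into one does not change the numbering. *)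
definition digit :: "nat list \<Rightarrow> nat \<Rightarrow> nat \<Rightarrow> nat" where
  "digit ds i l = i div prod_list (drop (Suc l) ds) mod (ds ! l)"

(* The operator acting as M on the l-th tensor factor and as the identity on all others. *)
definition local_op :: "nat list \<Rightarrow> nat \<Rightarrow> complex mat \<Rightarrow> complex mat" where
  "local_op ds l M = mat (prod_list ds) (prod_list ds) (\<lambda>(i, j).
     if \<forall>m<length ds. m \<noteq> l \<longrightarrow> digit ds i m = digit ds j m
     then M $$ (digit ds i l, digit ds j l) else 0)"

(* The marginal of \<rho> on the factors js ! 0, js ! 1, ..., in this order (js is meant to be a
   list of distinct positions): the other factors are traced out by summing over the pairs (i, j)
   of basis numbers with equal digits there. If js lists all positions, nothing is traced out and
   the tensor factors are just reordered. *)
definition marginal :: "nat list \<Rightarrow> nat list \<Rightarrow> complex mat \<Rightarrow> complex mat" where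
  "marginal ds js \<rho> =
     (let es = map (\<lambda>j. ds ! j) js in
      mat (prod_list es) (prod_list es) (\<lambda>(p, q).
        \<Sum>(i, j) \<in> {(i, j). i < prod_list ds \<and> j < prod_list ds \<and>
                       (\<forall>r<length js. digit ds i (js ! r) = digit es p r \<and>
                                      digit ds j (js ! r) = digit es q r) \<and>
                       (\<forall>m<length ds. m \<notin> set js \<longrightarrow> digit ds i m = digit ds j m)}.
          \<rho> $$ (i, j)))"

(* \<rho> is a state on A (x) B, with A of dimension dA and B of dimension dB; in the extension,
   A is factor 0 and B_1, ..., B_k are the factors 1, ..., k. *)
definition bipartite_k_extendible :: "nat \<Rightarrow> nat \<Rightarrow> nat \<Rightarrow> complex mat \<Rightarrow> bool" where
  "bipartite_k_extendible dA dB k \<rho> \<longleftrightarrow>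
     density_operator (dA * dB) \<rho> \<and>
     (\<exists>\<tau>. density_operator (dA * dB ^ k) \<tau> \<and>
          (\<forall>i\<in>{1..k}. marginal (dA # replicate k dB) [0, i] \<tau> = \<rho>))"

(* Subsystem l takes the role of B. The remaining subsystems, in their original order, are
   together A; for this, factor l is first moved to the last position. *)
definition k_extendible_wrt :: "nat list \<Rightarrow> nat \<Rightarrow> nat \<Rightarrow> complex mat \<Rightarrow> bool" where
  "k_extendible_wrt ds l k \<rho> \<longleftrightarrow>
     (let rest = filter (\<lambda>m. m \<noteq> l) [0..<length ds] in
      bipartite_k_extendible (prod_list (map (\<lambda>m. ds ! m) rest)) (ds ! l) k
        (marginal ds (rest @ [l]) \<rho>))"

definition k_extendible :: "nat list \<Rightarrow> nat \<Rightarrow> complex mat \<Rightarrow> bool" where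
  "k_extendible ds k \<rho> \<longleftrightarrow> (\<forall>l<length ds. k_extendible_wrt ds l k \<rho>)"

definition k_unextendible :: "nat list \<Rightarrow> nat \<Rightarrow> complex mat \<Rightarrow> bool" where
  "k_unextendible ds k \<rho> \<longleftrightarrow> \<not> k_extendible ds k \<rho>"

definition pauli :: "nat \<Rightarrow> complex mat" where
  "pauli i =
     (if i = 1 then mat_of_rows_list 2 [[0, 1], [1, 0]]
      else if i = 2 then mat_of_rows_list 2 [[0, - \<i>], [\<i>, 0]]
      else mat_of_rows_list 2 [[1, 0], [0, - 1]])"

abbreviation qubits :: "nat \<Rightarrow> nat list" where
  "qubits n \<equiv> replicate n 2"

definition pauli_dot :: "nat \<Rightarrow> nat \<Rightarrow> nat \<Rightarrow> complex mat" where
  "pauli_dot n l m =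
     mat_sum (2 ^ n) (\<lambda>i. local_op (qubits n) l (pauli i) * local_op (qubits n) m (pauli i)) {1..3}"

(* The sites, taken modulo 2 * N, are represented by 0, ..., 2 * N - 1. *)
definition J1_J2_hamiltonian :: "real \<Rightarrow> real \<Rightarrow> nat \<Rightarrow> complex mat" where
  "J1_J2_hamiltonian J1 J2 N =
     complex_of_real J1 \<cdot>\<^sub>m
       mat_sum (2 ^ (2 * N)) (\<lambda>l. pauli_dot (2 * N) l ((l + 1) mod (2 * N))) {0..<2 * N} +
     complex_of_real J2 \<cdot>\<^sub>m
       mat_sum (2 ^ (2 * N)) (\<lambda>l. pauli_dot (2 * N) l ((l + 2) mod (2 * N))) {0..<2 * N}"

end

theory Submission
  imports Defs
begin

text \<open>
  For two distinct qubits, \<open>\<sigma>\<^sup>l \<cdot> \<sigma>\<^sup>m = 2 P - 1\<close> with \<open>P\<close> the swap of \<open>l\<close> and \<open>m\<close>. Let \<open>\<tau>\<close> extend \<open>\<rho>\<close>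
  to \<open>k\<close> copies \<open>b\<close> of the site \<open>m\<close>, and let \<open>y\<close> be the expectation of \<open>Y = \<Sum>\<^sub>b P\<^sub>l\<^sub>b\<close> in \<open>\<tau>\<close>, which is \<open>k\<close> times
  that of \<open>P\<close> in \<open>\<rho>\<close>. Since three qubits have no antisymmetric states, each pair of copies satisfies
  \<open>P\<^sub>l\<^sub>b P\<^sub>l\<^sub>c + P\<^sub>l\<^sub>c P\<^sub>l\<^sub>b = P\<^sub>l\<^sub>b + P\<^sub>l\<^sub>c + P\<^sub>b\<^sub>c - 1\<close>, and \<open>P\<^sub>b\<^sub>c \<le> 1\<close> gives \<open>Y\<^sup>2 \<le> k + (k - 1) Y\<close>. With \<open>y\<^sup>2 \<le> \<langle>Y\<^sup>2\<rangle>\<close>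
  this means \<open>(y + 1) (y - k) \<le> 0\<close>, so \<open>y \<ge> -1\<close>, and each bond of a \<open>k\<close>-extendible state has energy at least
  \<open>-1 - 2 / k\<close>. For \<open>N = 1\<close> the bond from \<open>l\<close> to \<open>l + 2\<close> joins \<open>l\<close> to itself; its energy is nonnegative
  because the operator is a sum of squares.
\<close>

section \<open>Mixed-radix digits\<close>

lemma div_mod_eq_mod_mult_div: "(i::nat) div q mod d = i mod (q * d) div q"
  by (cases "q = 0") (simp_all add: mod_mult2_eq)

lemma digit_less: "0 < ds ! l \<Longrightarrow> digit ds i l < ds ! l"
  by (simp add: digit_def)

lemma digit_Cons_Suc: "digit (d # ds) i (Suc l) = digit ds i l"
  by (simp add: digit_def)

lemma digit_Cons_0: "i < d * prod_list ds \<Longrightarrow> digit (d # ds) i 0 = i div prod_list ds"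
  by (simp add: digit_def less_mult_imp_div_less)

lemma digit_append_left:
  "l < length ds \<Longrightarrow> digit (ds @ es) i l = digit ds (i div prod_list es) l"
  by (simp add: digit_def nth_append div_mult2_eq [symmetric] mult.commute)

lemma digit_append_right: "digit (ds @ es) i (length ds + l) = digit es i l"
  by (simp add: digit_def nth_append)

text \<open>Digit \<open>l\<close> depends only on \<open>i\<close> modulo the product of the
  dimensions from position \<open>l\<close> on, and that product divides
  \<open>prod_list ds\<close>.\<close>

lemma digit_mod:
  assumes "l < length ds"
  shows "digit ds (i mod prod_list ds) l = digit ds i l"
proof -
  define Q where "Q = prod_list (drop (Suc l) ds)"
  have "prod_list ds = prod_list (take l ds @ ds ! l # drop (Suc l) ds)"
    using assms id_take_nth_drop by metis
  then have "Q * ds ! l dvd prod_list ds"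
    by (simp add: Q_def mult.commute)
  then show ?thesis
    unfolding digit_def Q_def [symmetric] div_mod_eq_mod_mult_div
    by (simp add: mod_mod_cancel)
qed

lemma digit_inj:
  assumes "i < prod_list ds" "j < prod_list ds" "\<forall>l<length ds. digit ds i l = digit ds j l"
  shows "i = j"
  using assms
proof (induction ds arbitrary: i j)
  case (Cons d ds)
  let ?P = "prod_list ds"
  have "?P > 0"
    using Cons.prems(1) by (metis gr0I mult_0_right not_less_zero prod_list.Cons)
  have "digit (d # ds) i 0 = digit (d # ds) j 0"
    using Cons.prems(3) by auto
  then have "i div ?P = j div ?P"
    using Cons.prems(1,2) by (simp add: digit_Cons_0)
  moreover have "digit ds i l = digit ds j l" if "l < length ds" for l
    using Cons.prems(3) that digit_Cons_Suc by (metis Suc_less_eq length_Cons)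
  then have "i mod ?P = j mod ?P"
    using \<open>?P > 0\<close> by (intro Cons.IH) (auto simp: digit_mod)
  ultimately show ?case
    by (metis div_mult_mod_eq)
qed simp

text \<open>By induction: the leading digit is put on top of the number that carries the other ones.
  Together with \<open>digit_inj\<close> this makes the numbering of the product basis a
  bijection.\<close>

lemma digit_surj:
  assumes "\<forall>l<length ds. x l < ds ! l"
  shows "\<exists>i<prod_list ds. \<forall>l<length ds. digit ds i l = x l"
  using assms
proof (induction ds arbitrary: x)
  case (Cons d ds)
  let ?P = "prod_list ds"
  have "x (Suc l) < ds ! l" if "l < length ds" for l
    using Cons.prems that by force
  then obtain i where i: "i < ?P" "\<forall>l<length ds. digit ds i l = x (Suc l)"
    using Cons.IH [of "\<lambda>l. x (Suc l)"] by auto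
  let ?j = "x 0 * ?P + i"
  have "?P \<noteq> 0"
    using i(1) by linarith
  then have j: "?j div ?P = x 0" "?j mod ?P = i"
    using i(1) by simp_all
  have "x 0 < d"
    using Cons.prems by force
  then have less: "?j < prod_list (d # ds)"
    using i(1) mult_le_mono1 [of "Suc (x 0)" d ?P] by simp
  have "digit (d # ds) ?j l = x l" if "l < length (d # ds)" for l
  proof (cases l)
    case 0
    then show ?thesis using less j by (simp add: digit_Cons_0)
  next
    case (Suc m)
    then show ?thesis using that i j digit_mod by (metis digit_Cons_Suc Suc_less_eq length_Cons)
  qed
  then show ?case using less by blast
qed simp


section \<open>Basis numbers of qubits\<close>

lemma inj_on_digits:
  assumes "i < 2 ^ n" "j < 2 ^ n" "\<And>l. l < n \<Longrightarrow> digit (qubits n) i l = digit (qubits n) j l"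
  shows "i = j"
  using assms by (intro digit_inj [of i "qubits n"]) auto

text \<open>Inverse of reading off digits: the number exists by \<open>digit_surj\<close> and is
  unique by \<open>inj_on_digits\<close>. The value is unspecified if some \<open>x l\<close> with
  \<open>l < n\<close> is not a binary digit.\<close>

definition of_digits :: "nat \<Rightarrow> (nat \<Rightarrow> nat) \<Rightarrow> nat" where
  "of_digits n x = (SOME i. i < 2 ^ n \<and> (\<forall>l<n. digit (qubits n) i l = x l))"

lemma of_digits:
  assumes "\<And>l. l < n \<Longrightarrow> x l < 2"
  shows "of_digits n x < 2 ^ n" and "\<And>l. l < n \<Longrightarrow> digit (qubits n) (of_digits n x) l = x l"
proof -
  have "\<exists>i. i < 2 ^ n \<and> (\<forall>l<n. digit (qubits n) i l = x l)"
    using digit_surj [of "qubits n" x] assms by auto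
  from someI_ex [OF this]
  show "of_digits n x < 2 ^ n" and "\<And>l. l < n \<Longrightarrow> digit (qubits n) (of_digits n x) l = x l"
    by (simp_all add: of_digits_def)
qed

lemma digit_qubits_less: "l < n \<Longrightarrow> digit (qubits n) i l < 2"
  using digit_less [of "qubits n" l i] by simp

section \<open>Swaps and marginals\<close>

text \<open>Positions of the entries 1 of the permutation matrix that swaps qubits \<open>a\<close>
  and \<open>b\<close>. Here \<open>transpose\<close> is the transposition of two points, not that
  of a matrix.\<close>

definition swap_pairs :: "nat \<Rightarrow> nat \<Rightarrow> nat \<Rightarrow> (nat \<times> nat) set" where
  "swap_pairs n a b = {(i, j). i < 2 ^ n \<and> j < 2 ^ n \<and>
     (\<forall>l<n. digit (qubits n) j l = digit (qubits n) i (transpose a b l))}"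

text \<open>This is \<open>Tr (\<rho> P)\<close> for the swap \<open>P\<close>, written over
  positions so that a partial trace merely regroups the sum.\<close>

definition swap_expectation :: "nat \<Rightarrow> nat \<Rightarrow> nat \<Rightarrow> complex mat \<Rightarrow> complex" where
  "swap_expectation n a b \<rho> = (\<Sum>(i, j)\<in>swap_pairs n a b. \<rho> $$ (i, j))"

lemma finite_swap_pairs [simp]: "finite (swap_pairs n a b)"
  by (rule finite_subset [of _ "{..<2 ^ n} \<times> {..<2 ^ n}"]) (auto simp: swap_pairs_def)

lemma transpose_nth_distinct:
  assumes "distinct js" "a < length js" "b < length js" "r < length js"
  shows "transpose (js ! a) (js ! b) (js ! r) = js ! transpose a b r"
  using assms by (auto simp: transpose_def nth_eq_iff_index_eq)

lemma transpose_less: "a < n \<Longrightarrow> b < n \<Longrightarrow> l < n \<Longrightarrow> transpose a b l < (n::nat)"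
  by (simp add: transpose_def)

text \<open>Each entry \<open>(p, q)\<close> of the marginal is a sum over a fibre
  \<open>M (p, q)\<close>. The fibres over the swap positions of the small system partition those of
  the large one, because a swap of two kept factors fixes all digits that are traced out.\<close>

lemma swap_expectation_marginal:
  assumes js: "distinct js" "set js \<subseteq> {..<n}" and m: "length js = m" and ab: "a < m" "b < m"
  shows "swap_expectation m a b (marginal (qubits n) js \<rho>)
       = swap_expectation n (js ! a) (js ! b) \<rho>"
proof -
  have jsn: "js ! r < n" if "r < m" for r
    using js m that nth_mem by fastforce
  have es: "map ((!) (qubits n)) js = qubits m"
    using js(2) m by (intro nth_equalityI) (auto simp: jsn)
  define M where "M = (\<lambda>(p, q). {(i, j). i < 2 ^ n \<and> j < 2 ^ n \<and>
      (\<forall>r<m. digit (qubits n) i (js ! r) = digit (qubits m) p r \<and>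
             digit (qubits n) j (js ! r) = digit (qubits m) q r) \<and>
      (\<forall>l<n. l \<notin> set js \<longrightarrow> digit (qubits n) i l = digit (qubits n) j l)})"
  have finM: "finite (M pq)" for pq
    by (rule finite_subset [of _ "{..<2 ^ n} \<times> {..<2 ^ n}"]) (auto simp: M_def)
  have entry: "marginal (qubits n) js \<rho> $$ pq = (\<Sum>ij\<in>M pq. \<rho> $$ ij)"
    if "pq \<in> swap_pairs m a b" for pq
  proof -
    obtain p q where pq: "pq = (p, q)"
      by (cases pq)
    then have less: "p < 2 ^ m" "q < 2 ^ m"
      using that by (auto simp: swap_pairs_def)
    show ?thesis
      unfolding pq M_def marginal_def Let_def es using less m
      by (auto intro!: sum.cong simp: case_prod_beta)
  qed
  have disj: "pq = pq'" if "pq \<in> swap_pairs m a b" "pq' \<in> swap_pairs m a b" "ij \<in> M pq" "ij \<in> M pq'"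
    for pq pq' ij
  proof -
    obtain p q p' q' i j where [simp]: "pq = (p, q)" "pq' = (p', q')" "ij = (i, j)"
      by (metis surj_pair)
    have "p = p'"
      by (rule inj_on_digits [of _ m]) (use that in \<open>simp_all add: M_def swap_pairs_def\<close>)
    moreover have "q = q'"
      by (rule inj_on_digits [of _ m]) (use that in \<open>simp_all add: M_def swap_pairs_def\<close>)
    ultimately show ?thesis
      by simp
  qed
  have UN: "(\<Union>pq\<in>swap_pairs m a b. M pq) = swap_pairs n (js ! a) (js ! b)" (is "?L = ?R")
  proof (rule subset_antisym; rule subsetI)
    fix ij assume "ij \<in> ?L"
    then obtain p q where pq: "(p, q) \<in> swap_pairs m a b" "ij \<in> M (p, q)"
      by auto
    then obtain i j where ij: "ij = (i, j)" and less: "i < 2 ^ n" "j < 2 ^ n"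
      by (auto simp: M_def)
    have "digit (qubits n) j l = digit (qubits n) i (transpose (js ! a) (js ! b) l)" if "l < n" for l
    proof (cases "l \<in> set js")
      case True
      then obtain r where r: "r < m" "l = js ! r"
        using m by (auto simp: in_set_conv_nth)
      have "transpose a b r < m"
        using ab r by (simp add: transpose_less)
      then show ?thesis
        using pq r js ab m by (auto simp: ij M_def swap_pairs_def transpose_nth_distinct)
    next
      case False
      then have "transpose (js ! a) (js ! b) l = l"
        using ab m by (metis nth_mem transpose_apply_other)
      then show ?thesis
        using pq False that by (auto simp: ij M_def)
    qed
    then show "ij \<in> ?R"
      using less by (simp add: ij swap_pairs_def)
  next
    fix ij assume "ij \<in> ?R"
    then obtain i j where ij: "ij = (i, j)" and less: "i < 2 ^ n" "j < 2 ^ n"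
      and eq: "\<And>l. l < n \<Longrightarrow> digit (qubits n) j l = digit (qubits n) i (transpose (js ! a) (js ! b) l)"
      by (auto simp: swap_pairs_def)
    \<comment> \<open>The kept digits of \<open>i\<close> and \<open>j\<close>, in the order of
      \<open>js\<close>, name the entry of the marginal to which \<open>(i, j)\<close>
      contributes.\<close>
    define p where "p = of_digits m (\<lambda>r. digit (qubits n) i (js ! r))"
    define q where "q = of_digits m (\<lambda>r. digit (qubits n) j (js ! r))"
    have p: "p < 2 ^ m" "\<And>r. r < m \<Longrightarrow> digit (qubits m) p r = digit (qubits n) i (js ! r)"
      unfolding p_def using of_digits [of m "\<lambda>r. digit (qubits n) i (js ! r)"]
      by (simp_all add: digit_qubits_less jsn)
    have q: "q < 2 ^ m" "\<And>r. r < m \<Longrightarrow> digit (qubits m) q r = digit (qubits n) j (js ! r)"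
      unfolding q_def using of_digits [of m "\<lambda>r. digit (qubits n) j (js ! r)"]
      by (simp_all add: digit_qubits_less jsn)
    have "(p, q) \<in> swap_pairs m a b"
      using p q eq js m ab by (simp add: swap_pairs_def transpose_less jsn transpose_nth_distinct)
    moreover have "transpose (js ! a) (js ! b) l = l" if "l \<notin> set js" for l
      using ab m that by (metis nth_mem transpose_apply_other)
    then have "ij \<in> M (p, q)"
      using p q less eq by (simp add: M_def ij)
    ultimately show "ij \<in> ?L" by blast
  qed
  have "swap_expectation m a b (marginal (qubits n) js \<rho>) = (\<Sum>pq\<in>swap_pairs m a b. \<Sum>ij\<in>M pq. \<rho> $$ ij)"
    unfolding swap_expectation_def by (auto intro!: sum.cong simp: entry)
  also have "\<dots> = (\<Sum>ij\<in>(\<Union>pq\<in>swap_pairs m a b. M pq). \<rho> $$ ij)"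
    using disj by (intro sum.UNION_disjoint [symmetric]) (auto simp: finM)
  finally show ?thesis
    by (simp add: UN swap_expectation_def case_prod_beta')
qed

section \<open>Splitting the factor A into qubits\<close>

lemma digit_merge_first:
  assumes "l < a"
  shows "digit (qubits (a + k)) i l = digit (qubits a) (digit (2 ^ a # qubits k) i 0) l"
proof -
  have "digit (qubits (a + k)) i l = digit (qubits a) (i div 2 ^ k) l"
    using digit_append_left [of l "qubits a" "qubits k" i] assms by (simp add: replicate_add)
  also have "\<dots> = digit (qubits a) (i div 2 ^ k mod 2 ^ a) l"
    using digit_mod [of l "qubits a"] assms by simp
  finally show ?thesis
    by (simp add: digit_def)
qed

lemma digit_merge_rest:
  "digit (qubits (a + k)) i (a + l) = digit (2 ^ a # qubits k) i (Suc l)"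
  using digit_append_right [of "qubits a" "qubits k" i l] by (simp add: digit_Cons_Suc replicate_add)

lemma digit_merge_first_eq_iff:
  "digit (2 ^ a # qubits k) i 0 = digit (2 ^ a # qubits k') j 0 \<longleftrightarrow>
   (\<forall>l<a. digit (qubits (a + k)) i l = digit (qubits (a + k')) j l)"
    (is "?i = ?j \<longleftrightarrow> _")
proof -
  have "?i < 2 ^ a" "?j < 2 ^ a"
    by (simp_all add: digit_def)
  then have "?i = ?j \<longleftrightarrow> (\<forall>l<a. digit (qubits a) ?i l = digit (qubits a) ?j l)"
    by (metis inj_on_digits)
  then show ?thesis
    by (metis digit_merge_first)
qed

text \<open>Bipartite extendibility treats A as one factor of dimension \<open>2 ^ a\<close>,
  whereas swaps act on its qubits. Splitting A keeps the numbering of the basis, so both marginals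
  sum the same entries.\<close>

lemma marginal_merge:
  assumes t: "t < k"
  shows "marginal (2 ^ a # qubits k) [0, Suc t] \<tau> = marginal (qubits (a + k)) ([0..<a] @ [a + t]) \<tau>"
proof -
  let ?D = "2 ^ a # qubits k" and ?Q = "qubits (a + k)" and ?E = "2 ^ a # qubits 1"
  have es1: "map ((!) ?D) [0, Suc t] = ?E"
    using t by simp
  have es2: "map ((!) ?Q) ([0..<a] @ [a + t]) = qubits (a + 1)"
    using t by (intro nth_equalityI) (auto simp: nth_append simp del: replicate_Suc)
  \<comment> \<open>Agreement in the single digit of A is agreement in its \<open>a\<close> binary
    digits, and factor \<open>Suc t\<close> becomes qubit \<open>a + t\<close>.\<close>
  have one: "(\<forall>r<length [0, Suc t]. digit ?D i ([0, Suc t] ! r) = digit ?E p r) \<longleftrightarrow>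
      (\<forall>r<length ([0..<a] @ [a + t]). digit ?Q i (([0..<a] @ [a + t]) ! r) = digit (qubits (a + 1)) p r)"
      (is "?L \<longleftrightarrow> ?R") for i p
  proof -
    have "?L \<longleftrightarrow> digit ?D i 0 = digit ?E p 0 \<and> digit ?D i (Suc t) = digit ?E p (Suc 0)"
      by (auto simp: less_Suc_eq)
    also have "\<dots> \<longleftrightarrow> (\<forall>l<a. digit ?Q i l = digit (qubits (a + 1)) p l)
        \<and> digit ?Q i (a + t) = digit (qubits (a + 1)) p (a + 0)"
      by (simp only: digit_merge_first_eq_iff digit_merge_rest)
    also have "\<dots> \<longleftrightarrow> ?R"
      by (auto simp: nth_append less_Suc_eq)
    finally show ?thesis .
  qed
  have two: "(\<forall>m<length ?D. m \<notin> set [0, Suc t] \<longrightarrow> digit ?D i m = digit ?D j m) \<longleftrightarrow>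
      (\<forall>m<length ?Q. m \<notin> set ([0..<a] @ [a + t]) \<longrightarrow> digit ?Q i m = digit ?Q j m)"
      (is "?L \<longleftrightarrow> ?R") for i j
  proof -
    have "?L \<longleftrightarrow> (\<forall>l<k. l \<noteq> t \<longrightarrow> digit ?D i (Suc l) = digit ?D j (Suc l))"
      by (auto simp: less_Suc_eq_0_disj)
    also have "\<dots> \<longleftrightarrow> (\<forall>l<k. l \<noteq> t \<longrightarrow> digit ?Q i (a + l) = digit ?Q j (a + l))"
      by (simp only: digit_merge_rest)
    also have "\<dots> \<longleftrightarrow> ?R"
    proof
      assume L: "\<forall>l<k. l \<noteq> t \<longrightarrow> digit ?Q i (a + l) = digit ?Q j (a + l)"
      show ?R
      proof (intro allI impI)
        fix m assume "m < length ?Q" "m \<notin> set ([0..<a] @ [a + t])"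
        then show "digit ?Q i m = digit ?Q j m"
          using L [rule_format, of "m - a"] by auto
      qed
    qed auto
    finally show ?thesis .
  qed
  have dims: "prod_list ?D = prod_list ?Q" "prod_list ?E = prod_list (qubits (a + 1))"
    by (simp_all add: power_add)
  have "{(i, j). i < prod_list ?D \<and> j < prod_list ?D \<and>
          (\<forall>r<length [0, Suc t]. digit ?D i ([0, Suc t] ! r) = digit ?E p r \<and>
                                 digit ?D j ([0, Suc t] ! r) = digit ?E q r) \<and>
          (\<forall>m<length ?D. m \<notin> set [0, Suc t] \<longrightarrow> digit ?D i m = digit ?D j m)} =
        {(i, j). i < prod_list ?Q \<and> j < prod_list ?Q \<and>
          (\<forall>r<length ([0..<a] @ [a + t]).
             digit ?Q i (([0..<a] @ [a + t]) ! r) = digit (qubits (a + 1)) p r \<and>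
             digit ?Q j (([0..<a] @ [a + t]) ! r) = digit (qubits (a + 1)) q r) \<and>
          (\<forall>m<length ?Q. m \<notin> set ([0..<a] @ [a + t]) \<longrightarrow> digit ?Q i m = digit ?Q j m)}" for p q
    \<comment> \<open>The conditions on \<open>i\<close> and \<open>j\<close> are separated first,
      so that \<open>one\<close> rewrites each of them.\<close>
    unfolding imp_conjR all_conj_distrib one two dims ..
  then show ?thesis
    unfolding marginal_def Let_def es1 es2 dims by simp
qed


section \<open>Expectations of swaps\<close>

lemma density_operator_trace: "density_operator d \<rho> \<Longrightarrow> (\<Sum>i<d. \<rho> $$ (i, i)) = 1"
  by (auto simp: density_operator_def mat_trace_def)

lemma density_operator_nonneg:
  assumes "density_operator d \<rho>"
  shows "0 \<le> Re (\<Sum>i<d. \<Sum>j<d. \<rho> $$ (i, j) * v j * cnj (v i))"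
proof -
  have carr: "\<rho> \<in> carrier_mat d d"
    and pos: "0 \<le> Re ((\<rho> *\<^sub>v vec d v) \<bullet>c vec d v)"
    using assms by (auto simp: density_operator_def)
  have "(\<rho> *\<^sub>v vec d v) \<bullet>c vec d v = (\<Sum>i<d. (\<Sum>j<d. \<rho> $$ (i, j) * v j) * cnj (v i))"
    using carr by (simp add: scalar_prod_def lessThan_atLeast0)
  then show ?thesis
    using pos by (simp add: sum_distrib_right)
qed

text \<open>
  This is \<open>Tr (\<tau> C C\<^sup>*) \<ge> 0\<close> for \<open>C\<close> the combination with coefficients \<open>c\<close> of the permutation matrices of
  the involutions \<open>f g\<close>.
\<close>

lemma density_operator_involutions:
  assumes \<tau>: "density_operator D \<tau>" and "finite G"
    and less: "\<And>g i. g \<in> G \<Longrightarrow> i < D \<Longrightarrow> f g i < D"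
    and inv: "\<And>g i. g \<in> G \<Longrightarrow> i < D \<Longrightarrow> f g (f g i) = i"
  shows "0 \<le> (\<Sum>g\<in>G. \<Sum>h\<in>G. c g * c h * Re (\<Sum>i<D. \<tau> $$ (i, f g (f h i))))"
proof -
  \<comment> \<open>\<open>v r\<close> is column \<open>r\<close> of \<open>C\<close>; the quadratic
    form of \<open>\<tau>\<close> at \<open>v r\<close>, summed over \<open>r\<close>, is the
    trace.\<close>
  define v where "v = (\<lambda>r j. \<Sum>g\<in>G. if j = f g r then complex_of_real (c g) else 0)"
  have "(\<Sum>i<D. \<Sum>j<D. \<tau> $$ (i, j) * v r j * cnj (v r i)) =
      (\<Sum>g\<in>G. \<Sum>h\<in>G. of_real (c g * c h) * \<tau> $$ (f h r, f g r))" if "r < D" for r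
  proof -
    have *: "(\<Sum>j<D. F j * v r j) = (\<Sum>g\<in>G. of_real (c g) * F (f g r))" for F
    proof -
      have "(\<Sum>j<D. F j * v r j) = (\<Sum>g\<in>G. \<Sum>j<D. if j = f g r then of_real (c g) * F j else 0)"
        unfolding v_def sum_distrib_left by (subst sum.swap) (auto intro!: sum.cong)
      also have "\<dots> = (\<Sum>g\<in>G. of_real (c g) * F (f g r))"
        using less that by (auto intro!: sum.cong)
      finally show ?thesis .
    qed
    have cnj: "cnj (v r i) = v r i" for i
      by (simp add: v_def if_distrib cong: if_cong)
    have "(\<Sum>i<D. \<Sum>j<D. \<tau> $$ (i, j) * v r j * cnj (v r i)) =
        (\<Sum>i<D. (\<Sum>j<D. \<tau> $$ (i, j) * v r j) * v r i)"
      by (simp add: cnj sum_distrib_right)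
    also have "\<dots> = (\<Sum>h\<in>G. of_real (c h) * (\<Sum>g\<in>G. of_real (c g) * \<tau> $$ (f h r, f g r)))"
      by (simp only: *)
    also have "\<dots> = (\<Sum>g\<in>G. \<Sum>h\<in>G. of_real (c g * c h) * \<tau> $$ (f h r, f g r))"
      by (subst sum.swap) (simp add: sum_distrib_left mult_ac)
    finally show ?thesis .
  qed
  then have nonneg: "0 \<le> Re (\<Sum>g\<in>G. \<Sum>h\<in>G. of_real (c g * c h) * \<tau> $$ (f h r, f g r))" if "r < D" for r
    using density_operator_nonneg [OF \<tau>, of "v r"] that by simp
  have "0 \<le> (\<Sum>r<D. \<Sum>g\<in>G. \<Sum>h\<in>G. c g * c h * Re (\<tau> $$ (f h r, f g r)))"
    by (rule sum_nonneg) (use nonneg in simp)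
  also have "\<dots> = (\<Sum>g\<in>G. \<Sum>h\<in>G. c g * c h * (\<Sum>r<D. Re (\<tau> $$ (f h r, f g r))))"
    unfolding sum_distrib_left
    by (subst sum.swap, rule sum.cong [OF refl], subst sum.swap, rule refl)
  also have "\<dots> = (\<Sum>g\<in>G. \<Sum>h\<in>G. c g * c h * Re (\<Sum>i<D. \<tau> $$ (i, f g (f h i))))"
  proof (intro sum.cong refl)
    fix g h assume gh: "g \<in> G" "h \<in> G"
    \<comment> \<open>Substitution \<open>i = f h r\<close>, which is its own inverse.\<close>
    have "(\<Sum>r<D. Re (\<tau> $$ (f h r, f g r))) = (\<Sum>i<D. Re (\<tau> $$ (i, f g (f h i))))"
      by (rule sum.reindex_bij_witness [of _ "f h" "f h"]) (use gh less inv in auto)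
    then show "c g * c h * (\<Sum>r<D. Re (\<tau> $$ (f h r, f g r))) =
        c g * c h * Re (\<Sum>i<D. \<tau> $$ (i, f g (f h i)))"
      by simp
  qed
  finally show ?thesis .
qed

section \<open>Swaps as permutations of the basis numbers\<close>

definition swap_index :: "nat \<Rightarrow> nat \<Rightarrow> nat \<Rightarrow> nat \<Rightarrow> nat" where
  "swap_index n a b i = of_digits n (\<lambda>l. digit (qubits n) i (transpose a b l))"

context
  fixes n a b :: nat
  assumes ab: "a < n" "b < n"
begin

lemma swap_index_less: "swap_index n a b i < 2 ^ n"
  unfolding swap_index_def using ab by (intro of_digits) (simp add: transpose_less digit_qubits_less)

lemma digit_swap_index:
  "l < n \<Longrightarrow> digit (qubits n) (swap_index n a b i) l = digit (qubits n) i (transpose a b l)"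
  unfolding swap_index_def using ab by (subst of_digits) (simp_all add: transpose_less digit_qubits_less)

lemma swap_index_eqI:
  assumes "j < 2 ^ n" "\<And>l. l < n \<Longrightarrow> digit (qubits n) j l = digit (qubits n) i (transpose a b l)"
  shows "swap_index n a b i = j"
  by (rule inj_on_digits [of _ n]) (simp_all add: swap_index_less digit_swap_index assms)

lemma swap_index_involutory: "i < 2 ^ n \<Longrightarrow> swap_index n a b (swap_index n a b i) = i"
  using ab by (intro swap_index_eqI) (simp_all add: digit_swap_index transpose_less)

lemma swap_expectation_eq: "swap_expectation n a b \<rho> = (\<Sum>i<2 ^ n. \<rho> $$ (i, swap_index n a b i))"
proof -
  have "swap_pairs n a b = (\<lambda>i. (i, swap_index n a b i)) ` {..<2 ^ n}"
    using swap_index_eqI by (auto simp: swap_pairs_def swap_index_less digit_swap_index)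
  then show ?thesis
    unfolding swap_expectation_def by (simp add: sum.reindex inj_on_def)
qed

end

lemma swap_index_same: "a < n \<Longrightarrow> i < 2 ^ n \<Longrightarrow> swap_index n a a i = i"
  by (intro swap_index_eqI) simp_all

text \<open>For the swap \<open>P\<close>, \<open>(P - 1)\<^sup>2 = 2 - 2 P\<close>, and the
  expectation of a square is nonnegative.\<close>

lemma swap_expectation_le_1:
  assumes \<tau>: "density_operator (2 ^ n) \<tau>" and ab: "a < n" "b < n"
  shows "Re (swap_expectation n a b \<tau>) \<le> 1"
proof (cases "a = b")
  case True
  then show ?thesis
    using ab density_operator_trace [OF \<tau>] by (simp add: swap_expectation_eq swap_index_same)
next
  case False
  \<comment> \<open>The swap of \<open>a\<close> with itself serves as the identity, so index
    \<open>a\<close> carries its coefficient \<open>- 1\<close> and index \<open>b\<close> the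
    coefficient 1 of \<open>P\<close>.\<close>
  have "0 \<le> (\<Sum>g\<in>{a, b}. \<Sum>h\<in>{a, b}. (if g = a then - 1 else 1) * (if h = a then - 1 else 1) *
      Re (\<Sum>i<2 ^ n. \<tau> $$ (i, swap_index n a g (swap_index n a h i))))"
    by (rule density_operator_involutions [OF \<tau>])
      (use ab in \<open>auto simp: swap_index_less swap_index_involutory\<close>)
  then show ?thesis
    using False ab density_operator_trace [OF \<tau>]
    by (simp add: swap_expectation_eq swap_index_same swap_index_less swap_index_involutory flip: Re_sum)
qed

text \<open>Among the binary digits at \<open>a\<close>, \<open>b\<close> and \<open>c\<close> two are equal.\<close>

lemma swap_index_three_sites:
  fixes F :: "nat \<Rightarrow> complex"
  assumes abc: "a < n" "b < n" "c < n" and dist: "a \<noteq> b" "a \<noteq> c" "b \<noteq> c" and i: "i < 2 ^ n"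
  shows "F i + F (swap_index n a b (swap_index n a c i)) + F (swap_index n a c (swap_index n a b i)) =
    F (swap_index n a b i) + F (swap_index n a c i) + F (swap_index n b c i)"
proof -
  let ?d = "digit (qubits n) i"
  note simps = swap_index_less digit_swap_index transpose_less abc i
  have "?d a < 2" "?d b < 2" "?d c < 2"
    using abc by (simp_all add: digit_qubits_less)
  then consider "?d a = ?d b" | "?d a = ?d c" | "?d b = ?d c"
    by linarith
  \<comment> \<open>In each case one of the three swaps fixes \<open>i\<close>, and the six terms
    cancel in pairs.\<close>
  then show ?thesis
  proof cases
    case 1
    then have "swap_index n a b i = i"
      by (intro swap_index_eqI) (simp_all add: simps transpose_def)
    moreover have "swap_index n b c i = swap_index n a b (swap_index n a c i)"
      using 1 dist by (intro swap_index_eqI) (simp_all add: simps, simp add: transpose_def)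
    ultimately show ?thesis by simp
  next
    case 2
    then have "swap_index n a c i = i"
      by (intro swap_index_eqI) (simp_all add: simps transpose_def)
    moreover have "swap_index n b c i = swap_index n a c (swap_index n a b i)"
      using 2 dist by (intro swap_index_eqI) (simp_all add: simps, simp add: transpose_def)
    ultimately show ?thesis by simp
  next
    case 3
    then have "swap_index n b c i = i"
      by (intro swap_index_eqI) (simp_all add: simps transpose_def)
    moreover have "swap_index n a c i = swap_index n a b (swap_index n a c i)"
      using 3 dist by (intro swap_index_eqI) (simp_all add: simps, simp add: transpose_def)
    moreover have "swap_index n a b i = swap_index n a c (swap_index n a b i)"
      using 3 dist by (intro swap_index_eqI) (simp_all add: simps, simp add: transpose_def)
    ultimately show ?thesis by simp
  qed
qed

text \<open>The sum of the swaps has nonnegative variance, and the three-site identity bounds the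
  expectation of its square linearly in \<open>y\<close>. Together they confine \<open>y\<close> to
  the interval from \<open>- 1\<close> to \<open>card B\<close>.\<close>

lemma sum_swap_expectation_ge:
  assumes \<tau>: "density_operator (2 ^ n) \<tau>"
    and a: "a < n" "a \<notin> B" and B: "B \<subseteq> {..<n}"
  shows "- 1 \<le> (\<Sum>b\<in>B. Re (swap_expectation n a b \<tau>))"
proof -
  define W where "W = (\<lambda>g h. Re (\<Sum>i<2 ^ n. \<tau> $$ (i, swap_index n a g (swap_index n a h i))))"
  define e where "e = (\<lambda>b. Re (swap_expectation n a b \<tau>))"
  define y where "y = (\<Sum>b\<in>B. e b)"
  define c where "c = (\<lambda>g. if g = a then - y else 1)"
  have fin: "finite B"
    using B finite_subset by blast
  have Bn: "b < n" if "b \<in> B" for b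
    using B that by auto
  have c1: "c b = 1" if "b \<in> B" for b
    using a that by (auto simp: c_def)
  have ca: "c a = - y"
    by (simp add: c_def)
  have W_a: "W a b = e b" "W b a = e b" if "b < n" for b
    using a that unfolding W_def e_def
    by (simp_all add: swap_expectation_eq swap_index_same swap_index_less)
  have W_same: "W b b = 1" if "b < n" for b
    using a that density_operator_trace [OF \<tau>]
    by (simp add: W_def swap_index_involutory flip: Re_sum)
  have e_a: "e a = 1"
    using W_a(1) [of a] W_same [of a] a by simp
  \<comment> \<open>\<open>Tr (\<tau> (Y - y)\<^sup>2) \<ge> 0\<close>, where the identity is the swap of \<open>a\<close> with itself\<close>
  have "0 \<le> (\<Sum>g\<in>insert a B. \<Sum>h\<in>insert a B. c g * c h * W g h)"
    unfolding W_def
    by (rule density_operator_involutions [OF \<tau>])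
      (use a Bn fin in \<open>auto simp: swap_index_less swap_index_involutory\<close>)
  \<comment> \<open>The pair \<open>(a, a)\<close> contributes \<open>y * y\<close>; the pairs of
    \<open>a\<close> with elements of \<open>B\<close>, in either order, contribute
    \<open>- y * y\<close> each time.\<close>
  also have "\<dots> = y * y - 2 * y * y + (\<Sum>g\<in>B. \<Sum>h\<in>B. W g h)"
    using fin a Bn
    by (simp add: ca c1 W_a e_a sum.distrib sum_subtractf sum_negf y_def flip: sum_distrib_left sum_distrib_right cong: sum.cong)
  finally have lower: "y * y \<le> (\<Sum>g\<in>B. \<Sum>h\<in>B. W g h)"
    by simp
  \<comment> \<open>For \<open>g = h\<close> the left side is 2, and the correction term makes this
    an equality. For \<open>g \<noteq> h\<close> it is the three-site identity with the swap of
    \<open>g\<close> and \<open>h\<close> bounded by 1.\<close>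
  have W_le: "W g h + W h g \<le> e g + e h + (if g = h then 2 - 2 * e g else 0)"
    if "g \<in> B" "h \<in> B" for g h
  proof (cases "g = h")
    case True
    then show ?thesis
      using that Bn by (simp add: W_same)
  next
    case False
    then have ne: "a \<noteq> g" "a \<noteq> h" "g \<noteq> h"
      using a that by auto
    have "(\<Sum>i<2 ^ n. \<tau> $$ (i, i)) +
        (\<Sum>i<2 ^ n. \<tau> $$ (i, swap_index n a g (swap_index n a h i))) +
        (\<Sum>i<2 ^ n. \<tau> $$ (i, swap_index n a h (swap_index n a g i))) =
        (\<Sum>i<2 ^ n. \<tau> $$ (i, swap_index n a g i)) + (\<Sum>i<2 ^ n. \<tau> $$ (i, swap_index n a h i)) +
        (\<Sum>i<2 ^ n. \<tau> $$ (i, swap_index n g h i))"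
      unfolding sum.distrib [symmetric] using a that Bn ne
      by (intro sum.cong refl swap_index_three_sites) auto
    then have "1 + W g h + W h g = e g + e h + Re (swap_expectation n g h \<tau>)"
      using a that Bn density_operator_trace [OF \<tau>]
      by (simp add: W_def e_def swap_expectation_eq complex_eq_iff)
    then show ?thesis
      using swap_expectation_le_1 [OF \<tau>, of g h] Bn that False by simp
  qed
  \<comment> \<open>Doubling pairs each product of two swaps with the product in reverse
    order.\<close>
  have "2 * (\<Sum>g\<in>B. \<Sum>h\<in>B. W g h) = (\<Sum>g\<in>B. \<Sum>h\<in>B. W g h + W h g)"
    using sum.swap [of W B B] by (simp add: sum.distrib)
  also have "\<dots> \<le> (\<Sum>g\<in>B. \<Sum>h\<in>B. e g + e h + (if g = h then 2 - 2 * e g else 0))"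
    by (intro sum_mono W_le)
  also have "\<dots> = (\<Sum>g\<in>B. real (card B) * e g + y + 2 - 2 * e g)"
    using fin by (intro sum.cong refl) (simp add: sum.distrib y_def)
  also have "\<dots> = real (card B) * y + card B * y + 2 * card B - 2 * y"
    by (simp add: sum.distrib sum_subtractf y_def flip: sum_distrib_left)
  finally have "y * y \<le> real (card B) * y + card B - y"
    using lower by (simp add: algebra_simps)
  then have "(y + 1) * (y - card B) \<le> 0"
    by (simp add: algebra_simps)
  \<comment> \<open>Below \<open>- 1\<close> both factors are negative.\<close>
  moreover have "(y + 1) * (y - card B) > 0" if "y < - 1"
    using that by (intro mult_neg_neg) auto
  ultimately have "- 1 \<le> y"
    by fastforce
  then show ?thesis
    by (simp add: y_def e_def)
qed


section \<open>Spin interactions\<close>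

lemma mat_trace_mult:
  assumes "A \<in> carrier_mat d d" "B \<in> carrier_mat d d"
  shows "mat_trace (A * B) = (\<Sum>i<d. \<Sum>j<d. A $$ (i, j) * B $$ (j, i))"
  using assms by (auto simp: mat_trace_def scalar_prod_def lessThan_atLeast0 intro!: sum.cong)

lemma index_local_op:
  assumes "i < 2 ^ n" "j < 2 ^ n"
  shows "local_op (qubits n) l M $$ (i, j) =
    (if \<forall>m<n. m \<noteq> l \<longrightarrow> digit (qubits n) i m = digit (qubits n) j m
     then M $$ (digit (qubits n) i l, digit (qubits n) j l) else 0)"
  using assms by (simp add: local_op_def)

lemma local_op_carrier: "local_op (qubits n) l M \<in> carrier_mat (2 ^ n) (2 ^ n)"
  by (simp add: local_op_def)

lemma index_pauli_dot_sum:
  assumes "i < 2 ^ n" "j < 2 ^ n"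
  shows "pauli_dot n l m $$ (j, i) = (\<Sum>s\<in>{1..3}. \<Sum>r<2 ^ n.
    local_op (qubits n) l (pauli s) $$ (j, r) * local_op (qubits n) m (pauli s) $$ (r, i))"
  using assms carrier_matD [OF local_op_carrier [of n]]
  by (simp add: pauli_dot_def mat_sum_def scalar_prod_def lessThan_atLeast0)

lemma pauli_dot_carrier: "pauli_dot n l m \<in> carrier_mat (2 ^ n) (2 ^ n)"
  by (simp add: pauli_dot_def mat_sum_def)

text \<open>On two qubits, the sum of \<open>\<sigma>\<^sub>a \<otimes> \<sigma>\<^sub>a\<close> is
  twice the swap minus the identity. This is its entry in row \<open>(p, r)\<close> and column
  \<open>(q, s)\<close>, checked for all sixteen entries.\<close>

lemma pauli_completeness:
  assumes "p < 2" "q < 2" "r < 2" "s < 2"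
  shows "(\<Sum>a\<in>{1..3}. pauli a $$ (p, q) * pauli a $$ (r, s)) =
    (if p = s \<and> r = q then 2 else 0) - (if p = q \<and> r = s then 1 else 0)"
proof -
  have "{1..3} = {1, 2, 3 :: nat}"
    by auto
  moreover have "p = 0 \<or> p = 1" "q = 0 \<or> q = 1" "r = 0 \<or> r = 1" "s = 0 \<or> s = 1"
    using assms by auto
  ultimately show ?thesis
    by (elim disjE) (simp_all add: pauli_def mat_of_rows_list_def)
qed

lemma index_local_op_mult:
  assumes lm: "l < n" "m < n" "l \<noteq> m" and ij: "i < 2 ^ n" "j < 2 ^ n"
  shows "(\<Sum>r<2 ^ n. local_op (qubits n) l M $$ (j, r) * local_op (qubits n) m M' $$ (r, i)) =
    (if \<forall>x<n. x \<noteq> l \<and> x \<noteq> m \<longrightarrow> digit (qubits n) j x = digit (qubits n) i x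
     then M $$ (digit (qubits n) j l, digit (qubits n) i l) *
          M' $$ (digit (qubits n) j m, digit (qubits n) i m) else 0)" (is "_ = ?rhs")
proof -
  \<comment> \<open>The only intermediate basis number that contributes: the first factor forces the
    digits of \<open>j\<close> off \<open>l\<close>, the second the digit of \<open>i\<close> at
    \<open>l\<close>.\<close>
  define r where "r = of_digits n (\<lambda>x. digit (qubits n) (if x = l then i else j) x)"
  have r: "r < 2 ^ n" "\<And>x. x < n \<Longrightarrow> digit (qubits n) r x = digit (qubits n) (if x = l then i else j) x"
    unfolding r_def using of_digits [of n "\<lambda>x. digit (qubits n) (if x = l then i else j) x"]
    by (simp_all add: digit_qubits_less)
  let ?t = "\<lambda>r. local_op (qubits n) l M $$ (j, r) * local_op (qubits n) m M' $$ (r, i)"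
  have "?t r' = 0" if "r' < 2 ^ n" "r' \<noteq> r" for r'
  proof (rule ccontr)
    assume nz: "?t r' \<noteq> 0"
    have "r' = r"
    proof (rule inj_on_digits [of _ n])
      fix x assume x: "x < n"
      show "digit (qubits n) r' x = digit (qubits n) r x"
      proof (cases "x = l")
        case True
        then have "digit (qubits n) r' x = digit (qubits n) i x"
          using nz ij that lm x by (auto simp: index_local_op split: if_splits)
        then show ?thesis using True r x by simp
      next
        case False
        then have "digit (qubits n) j x = digit (qubits n) r' x"
          using nz ij that lm x by (auto simp: index_local_op split: if_splits)
        then show ?thesis using False r x by simp
      qed
    qed (use that r in auto)
    with that show False by simp
  qed
  then have "(\<Sum>r<2 ^ n. ?t r) = (\<Sum>r'<2 ^ n. if r' = r then ?t r else 0)"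
    by (intro sum.cong) auto
  also have "\<dots> = ?t r"
    using r(1) by simp
  also have "\<dots> = ?rhs"
  proof -
    have "(\<forall>x<n. x \<noteq> m \<longrightarrow> digit (qubits n) r x = digit (qubits n) i x) \<longleftrightarrow>
        (\<forall>x<n. x \<noteq> l \<and> x \<noteq> m \<longrightarrow> digit (qubits n) j x = digit (qubits n) i x)"
      using r(2) by auto
    moreover have "digit (qubits n) r m = digit (qubits n) j m"
      using r(2) [OF lm(2)] lm(3) by simp
    ultimately have "local_op (qubits n) m M' $$ (r, i) =
        (if \<forall>x<n. x \<noteq> l \<and> x \<noteq> m \<longrightarrow> digit (qubits n) j x = digit (qubits n) i x
         then M' $$ (digit (qubits n) j m, digit (qubits n) i m) else 0)"
      by (simp only: index_local_op [OF r(1) ij(1)])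
    moreover have "local_op (qubits n) l M $$ (j, r) = M $$ (digit (qubits n) j l, digit (qubits n) i l)"
      using ij(2) r lm(1) by (simp add: index_local_op)
    ultimately show ?thesis
      by (simp only: if_distrib [of "(*) _"] mult_zero_right)
  qed
  finally show ?thesis .
qed

lemma sum_if_const: "(\<Sum>x\<in>A. if P then f x else 0) = (if P then sum f A else 0)"
  by simp

text \<open>\<open>\<sigma>\<^sup>l \<cdot> \<sigma>\<^sup>m = 2 P - 1\<close> entry by entry:
  \<open>pauli_completeness\<close> at the two sites, with equal digits at all others.\<close>

lemma index_pauli_dot:
  assumes lm: "l < n" "m < n" "l \<noteq> m" and ij: "i < 2 ^ n" "j < 2 ^ n"
  shows "pauli_dot n l m $$ (j, i) =
    (if (i, j) \<in> swap_pairs n l m then 2 else 0) - (if i = j then 1 else 0)"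
proof -
  let ?d = "digit (qubits n)"
  define same where "same \<longleftrightarrow> (\<forall>x<n. x \<noteq> l \<and> x \<noteq> m \<longrightarrow> ?d j x = ?d i x)"
  have split: "(\<forall>x<n. P x) \<longleftrightarrow> (\<forall>x<n. x \<noteq> l \<and> x \<noteq> m \<longrightarrow> P x) \<and> P l \<and> P m" for P
    using lm by metis
  \<comment> \<open>The swap and the identity both require \<open>same\<close>, so only the digits
    at \<open>l\<close> and \<open>m\<close> tell them apart.\<close>
  have pair: "(i, j) \<in> swap_pairs n l m \<longleftrightarrow> same \<and> ?d j l = ?d i m \<and> ?d j m = ?d i l"
    using ij by (simp add: swap_pairs_def same_def split [of "\<lambda>x. ?d j x = ?d i (transpose l m x)"])
  have diagonal: "i = j \<longleftrightarrow> same \<and> ?d j l = ?d i l \<and> ?d j m = ?d i m"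
    unfolding same_def split [of "\<lambda>x. ?d j x = ?d i x", symmetric]
    using inj_on_digits [OF ij] by metis
  have "pauli_dot n l m $$ (j, i) =
      (if same then \<Sum>s\<in>{1..3}. pauli s $$ (?d j l, ?d i l) * pauli s $$ (?d j m, ?d i m) else 0)"
    unfolding index_pauli_dot_sum [OF ij] index_local_op_mult [OF assms] same_def
    by (rule sum_if_const)
  also have "(\<Sum>s\<in>{1..3}. pauli s $$ (?d j l, ?d i l) * pauli s $$ (?d j m, ?d i m)) =
      (if ?d j l = ?d i m \<and> ?d j m = ?d i l then 2 else 0) -
      (if ?d j l = ?d i l \<and> ?d j m = ?d i m then 1 else 0)"
    using lm by (intro pauli_completeness digit_qubits_less)
  finally show ?thesis
    unfolding pair diagonal by (cases same) (simp_all only: simp_thms if_True if_False diff_self)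
qed

lemma trace_pauli_dot:
  assumes \<rho>: "density_operator (2 ^ n) \<rho>" and lm: "l < n" "m < n" "l \<noteq> m"
  shows "mat_trace (\<rho> * pauli_dot n l m) = 2 * swap_expectation n l m \<rho> - 1"
proof -
  have "mat_trace (\<rho> * pauli_dot n l m) = (\<Sum>i<2 ^ n. \<Sum>j<2 ^ n. \<rho> $$ (i, j) * pauli_dot n l m $$ (j, i))"
    using \<rho> by (intro mat_trace_mult) (auto simp: density_operator_def pauli_dot_carrier)
  also have "\<dots> = (\<Sum>i<2 ^ n. \<Sum>j<2 ^ n.
      (if j = swap_index n l m i then 2 * \<rho> $$ (i, j) else 0) - (if i = j then \<rho> $$ (i, j) else 0))"
  proof (intro sum.cong refl)
    fix i j :: nat assume "i \<in> {..<2 ^ n}" "j \<in> {..<2 ^ n}"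
    then have ij: "i < 2 ^ n" "j < 2 ^ n"
      by auto
    have "(i, j) \<in> swap_pairs n l m \<longleftrightarrow> j = swap_index n l m i"
      using ij lm swap_index_eqI [of l n m j i]
      by (auto simp: swap_pairs_def digit_swap_index)
    then show "\<rho> $$ (i, j) * pauli_dot n l m $$ (j, i) =
        (if j = swap_index n l m i then 2 * \<rho> $$ (i, j) else 0) - (if i = j then \<rho> $$ (i, j) else 0)"
      by (simp add: index_pauli_dot [OF lm ij] algebra_simps)
  qed
  also have "\<dots> = 2 * swap_expectation n l m \<rho> - 1"
    using lm density_operator_trace [OF \<rho>]
    by (simp add: sum_subtractf swap_expectation_eq swap_index_less sum_distrib_left)
  finally show ?thesis .
qed

section \<open>Interaction of a site with itself\<close>

lemma cnj_pauli: "p < 2 \<Longrightarrow> q < 2 \<Longrightarrow> cnj (pauli a $$ (p, q)) = pauli a $$ (q, p)"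
  by (auto simp: less_2_cases_iff pauli_def mat_of_rows_list_def)

text \<open>Only the order of summation is swapped here: for fixed \<open>s\<close> and
  \<open>r\<close>, the inner double sum can then be a quadratic form of the state.\<close>

lemma sum_swap_pairs:
  "(\<Sum>i\<in>A. \<Sum>j\<in>B. \<Sum>s\<in>C. \<Sum>r\<in>D. f i j s r) = (\<Sum>s\<in>C. \<Sum>r\<in>D. \<Sum>i\<in>A. \<Sum>j\<in>B. f i j s r)"
proof -
  have "(\<Sum>i\<in>A. \<Sum>j\<in>B. \<Sum>s\<in>C. \<Sum>r\<in>D. f i j s r) = (\<Sum>s\<in>C. \<Sum>i\<in>A. \<Sum>j\<in>B. \<Sum>r\<in>D. f i j s r)"
    by (subst (2) sum.swap) (rule sum.swap)
  also have "\<dots> = (\<Sum>s\<in>C. \<Sum>i\<in>A. \<Sum>r\<in>D. \<Sum>j\<in>B. f i j s r)"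
    by (intro sum.cong refl sum.swap)
  also have "\<dots> = (\<Sum>s\<in>C. \<Sum>r\<in>D. \<Sum>i\<in>A. \<Sum>j\<in>B. f i j s r)"
    by (intro sum.cong refl sum.swap)
  finally show ?thesis .
qed

text \<open>Each summand is the expectation of the square of a Hermitian operator. The case arises
  for \<open>N = 1\<close>, where \<open>l + 2\<close> is \<open>l\<close> modulo
  \<open>2 * N\<close>.\<close>

lemma trace_pauli_dot_same_nonneg:
  assumes \<rho>: "density_operator (2 ^ n) \<rho>" and l: "l < n"
  shows "0 \<le> Re (mat_trace (\<rho> * pauli_dot n l l))"
proof -
  let ?L = "\<lambda>s. local_op (qubits n) l (pauli s)"
  have cnj: "cnj (?L s $$ (i, r)) = ?L s $$ (r, i)" if "i < 2 ^ n" "r < 2 ^ n" for i r s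
    using that l by (auto simp: index_local_op cnj_pauli digit_qubits_less)
  have "mat_trace (\<rho> * pauli_dot n l l) = (\<Sum>i<2 ^ n. \<Sum>j<2 ^ n. \<rho> $$ (i, j) * pauli_dot n l l $$ (j, i))"
    using \<rho> by (intro mat_trace_mult) (auto simp: density_operator_def pauli_dot_carrier)
  \<comment> \<open>Hermiticity makes the second factor the conjugate of an entry in the same column
    \<open>r\<close>.\<close>
  also have "\<dots> = (\<Sum>i<2 ^ n. \<Sum>j<2 ^ n. \<Sum>s\<in>{1..3}. \<Sum>r<2 ^ n. \<rho> $$ (i, j) * ?L s $$ (j, r) * cnj (?L s $$ (i, r)))"
    by (intro sum.cong refl) (simp add: index_pauli_dot_sum cnj sum_distrib_left mult.assoc)
  also have "\<dots> = (\<Sum>s\<in>{1..3}. \<Sum>r<2 ^ n. \<Sum>i<2 ^ n. \<Sum>j<2 ^ n. \<rho> $$ (i, j) * ?L s $$ (j, r) * cnj (?L s $$ (i, r)))"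
    by (rule sum_swap_pairs)
  finally have trace: "mat_trace (\<rho> * pauli_dot n l l) = \<dots>" .
  have "0 \<le> (\<Sum>s\<in>{1..3}. \<Sum>r<2 ^ n. Re (\<Sum>i<2 ^ n. \<Sum>j<2 ^ n. \<rho> $$ (i, j) * ?L s $$ (j, r) * cnj (?L s $$ (i, r))))"
    by (intro sum_nonneg density_operator_nonneg [OF \<rho>])
  then show ?thesis
    by (simp add: trace)
qed

section \<open>Bonds of extendible states\<close>

lemma swap_expectation_commute: "swap_expectation n a b \<rho> = swap_expectation n b a \<rho>"
  by (simp only: swap_expectation_def swap_pairs_def transpose_commute [of a b])

text \<open>Site \<open>l\<close> is the one that is copied and \<open>m\<close> lies in A. Swapping
  \<open>m\<close> with any of the \<open>k\<close> copies has the same expectation as swapping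
  \<open>l\<close> and \<open>m\<close> in \<open>\<rho>\<close>, and the \<open>k\<close> equal
  values add up to at least \<open>- 1\<close>.\<close>

lemma swap_expectation_k_extendible_ge:
  assumes ext: "k_extendible_wrt (qubits n) l k \<rho>"
    and lm: "l < n" "m < n" "l \<noteq> m" and k: "k > 0"
  shows "- 1 / k \<le> Re (swap_expectation n l m \<rho>)"
proof -
  define rest where "rest = filter (\<lambda>m. m \<noteq> l) [0..<n]"
  have set_rest: "set rest = {..<n} - {l}" and "distinct rest"
    by (auto simp: rest_def)
  then have len: "length rest = n - 1"
    using lm distinct_card [of rest] by simp
  obtain a where n: "n = Suc a"
    using lm by (cases n) auto
  have dims: "map ((!) (qubits n)) rest = qubits a"
  proof -
    have "map ((!) (qubits n)) rest = map (\<lambda>_. 2) rest"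
      using set_rest by (intro map_cong refl) simp
    then show ?thesis
      using len n by (simp add: map_replicate_const)
  qed
  \<comment> \<open>With A split into qubits, \<open>\<tau>\<close> has A at the positions below
    \<open>a\<close> and the copies of \<open>l\<close> at \<open>a\<close>, ...,
    \<open>a + k - 1\<close>.\<close>
  obtain \<tau> where \<tau>: "density_operator (2 ^ (a + k)) \<tau>"
    and marg: "\<And>t. t \<in> {1..k} \<Longrightarrow>
      marginal (2 ^ a # qubits k) [0, t] \<tau> = marginal (qubits n) (rest @ [l]) \<rho>"
    using ext lm unfolding k_extendible_wrt_def bipartite_k_extendible_def Let_def
    by (auto simp: rest_def [symmetric] dims power_add)
  have "m \<in> set rest"
    using set_rest lm by simp
  then obtain r where r: "r < a" "rest ! r = m"
    using len n by (auto simp: in_set_conv_nth)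
  have eq: "swap_expectation n l m \<rho> = swap_expectation (a + k) r (a + t) \<tau>" if t: "t < k" for t
  proof -
    \<comment> \<open>Moving \<open>l\<close> to the end puts it at position \<open>a\<close>, while
      \<open>m\<close> is at position \<open>r\<close>.\<close>
    have "swap_expectation n m l \<rho> = swap_expectation n r a (marginal (qubits n) (rest @ [l]) \<rho>)"
      using swap_expectation_marginal [of "rest @ [l]" n n r a \<rho>] set_rest \<open>distinct rest\<close> len lm n r
      by (auto simp: nth_append)
    \<comment> \<open>Copies are counted from 0 here and from 1 in the definition, hence
      \<open>Suc t\<close>.\<close>
    also have "\<dots> = swap_expectation n r a (marginal (qubits (a + k)) ([0..<a] @ [a + t]) \<tau>)"
      using marg [of "Suc t"] marginal_merge [OF t] t by simp
    also have "\<dots> = swap_expectation (a + k) r (a + t) \<tau>"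
    proof -
      have "set ([0..<a] @ [a + t]) \<subseteq> {..<a + k}"
        using t by auto
      from swap_expectation_marginal [OF _ this, of n r a \<tau>] show ?thesis
        using n r by (simp add: nth_append)
    qed
    finally show ?thesis
      by (simp only: swap_expectation_commute [of n l m])
  qed
  have "k * Re (swap_expectation n l m \<rho>) = (\<Sum>t<k. Re (swap_expectation (a + k) r (a + t) \<tau>))"
    by (simp add: eq [symmetric])
  also have "\<dots> = (\<Sum>b\<in>(+) a ` {..<k}. Re (swap_expectation (a + k) r b \<tau>))"
    by (simp add: sum.reindex)
  \<comment> \<open>The common site of all the swaps is \<open>r\<close>, which stands for
    \<open>m\<close>; the set \<open>B\<close> consists of the copies of \<open>l\<close>.\<close>
  also have "\<dots> \<ge> - 1"
    using r by (intro sum_swap_expectation_ge [OF \<tau>]) auto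
  finally show ?thesis
    using k by (simp add: field_simps)
qed

lemma trace_pauli_dot_ge:
  assumes \<rho>: "density_operator (2 ^ n) \<rho>" and ext: "k_extendible (qubits n) k \<rho>"
    and lm: "l < n" "m < n" and k: "k > 0"
  shows "- (1 + 2 / k) \<le> Re (mat_trace (\<rho> * pauli_dot n l m))"
proof (cases "l = m")
  case True
  have "0 \<le> 2 / real k"
    by simp
  then show ?thesis
    using trace_pauli_dot_same_nonneg [OF \<rho> lm(1)] unfolding True [symmetric] by linarith
next
  case False
  have "- 1 / k \<le> Re (swap_expectation n l m \<rho>)"
    using ext lm False k by (intro swap_expectation_k_extendible_ge) (auto simp: k_extendible_def)
  then show ?thesis
    by (simp add: trace_pauli_dot [OF \<rho> lm False])
qed

section \<open>Energy of the chain\<close>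

lemma mat_trace_hamiltonian:
  assumes "\<rho> \<in> carrier_mat (2 ^ (2 * N)) (2 ^ (2 * N))"
  shows "mat_trace (\<rho> * J1_J2_hamiltonian J1 J2 N) =
    J1 * (\<Sum>l<2 * N. mat_trace (\<rho> * pauli_dot (2 * N) l ((l + 1) mod (2 * N)))) +
    J2 * (\<Sum>l<2 * N. mat_trace (\<rho> * pauli_dot (2 * N) l ((l + 2) mod (2 * N))))"
proof -
  let ?n = "2 * N"
  let ?S = "\<lambda>s. mat_sum (2 ^ ?n) (\<lambda>l. pauli_dot ?n l ((l + s) mod ?n)) {0..<?n}"
  have S: "?S s \<in> carrier_mat (2 ^ ?n) (2 ^ ?n)" for s
    by (simp add: mat_sum_def)
  have sum: "(\<Sum>i<2 ^ ?n. \<Sum>j<2 ^ ?n. \<rho> $$ (i, j) * ?S s $$ (j, i)) =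
      (\<Sum>l<?n. mat_trace (\<rho> * pauli_dot ?n l ((l + s) mod ?n)))" for s
  proof -
    have "(\<Sum>i<2 ^ ?n. \<Sum>j<2 ^ ?n. \<rho> $$ (i, j) * ?S s $$ (j, i)) =
      (\<Sum>i<2 ^ ?n. \<Sum>j<2 ^ ?n. \<Sum>l<?n. \<rho> $$ (i, j) * pauli_dot ?n l ((l + s) mod ?n) $$ (j, i))"
      by (intro sum.cong refl) (simp add: mat_sum_def sum_distrib_left lessThan_atLeast0)
    also have "\<dots> = (\<Sum>i<2 ^ ?n. \<Sum>l<?n. \<Sum>j<2 ^ ?n. \<rho> $$ (i, j) * pauli_dot ?n l ((l + s) mod ?n) $$ (j, i))"
      by (intro sum.cong refl sum.swap)
    also have "\<dots> = (\<Sum>l<?n. \<Sum>i<2 ^ ?n. \<Sum>j<2 ^ ?n. \<rho> $$ (i, j) * pauli_dot ?n l ((l + s) mod ?n) $$ (j, i))"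
      by (rule sum.swap)
    finally show ?thesis
      using assms by (simp add: mat_trace_mult pauli_dot_carrier)
  qed
  have "J1_J2_hamiltonian J1 J2 N = complex_of_real J1 \<cdot>\<^sub>m ?S 1 + complex_of_real J2 \<cdot>\<^sub>m ?S 2"
    by (simp add: J1_J2_hamiltonian_def)
  moreover have "mat_trace (\<rho> * (complex_of_real J1 \<cdot>\<^sub>m ?S 1 + complex_of_real J2 \<cdot>\<^sub>m ?S 2)) =
    (\<Sum>i<2 ^ ?n. \<Sum>j<2 ^ ?n. J1 * (\<rho> $$ (i, j) * ?S 1 $$ (j, i)) + J2 * (\<rho> $$ (i, j) * ?S 2 $$ (j, i)))"
    using assms S by (subst mat_trace_mult) (auto intro!: sum.cong simp: algebra_simps mat_sum_def)
  ultimately show ?thesis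
    by (simp only: sum [symmetric] sum.distrib sum_distrib_left)
qed

theorem theorem2:
  fixes J1 J2 :: real and N k :: nat and \<rho> :: "complex mat"
  assumes "J1 > 0" and "J2 > 0" and "N \<ge> 1" and "k \<ge> 2"
    and "density_operator (2 ^ (2 * N)) \<rho>"
    and "Re (mat_trace (\<rho> * J1_J2_hamiltonian J1 J2 N))
           < - 2 * real N * (J1 + J2) * (1 + 2 / real k)"
  shows "k_unextendible (qubits (2 * N)) k \<rho>"
  unfolding k_unextendible_def
proof
  assume ext: "k_extendible (qubits (2 * N)) k \<rho>"
  \<comment> \<open>The shift \<open>s\<close> is 1 for the bonds with \<open>J1\<close> and 2 for
    those with \<open>J2\<close>; in both cases there are \<open>2 * N\<close> bonds.\<close>
  have bound: "- (2 * real N * (1 + 2 / k)) \<le> Re (\<Sum>l<2 * N. mat_trace (\<rho> * pauli_dot (2 * N) l ((l + s) mod (2 * N))))"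
    for s
  proof -
    have "- (2 * real N * (1 + 2 / k)) = (\<Sum>l<2 * N. - (1 + 2 / real k))"
      by (simp add: algebra_simps)
    also have "\<dots> \<le> (\<Sum>l<2 * N. Re (mat_trace (\<rho> * pauli_dot (2 * N) l ((l + s) mod (2 * N)))))"
      using assms by (intro sum_mono trace_pauli_dot_ge [OF _ ext]) auto
    finally show ?thesis
      by simp
  qed
  have "\<rho> \<in> carrier_mat (2 ^ (2 * N)) (2 ^ (2 * N))"
    using assms by (simp add: density_operator_def)
  from mat_trace_hamiltonian [OF this, of J1 J2]
  have "- (J1 * (2 * real N * (1 + 2 / k))) + - (J2 * (2 * real N * (1 + 2 / k)))
      \<le> Re (mat_trace (\<rho> * J1_J2_hamiltonian J1 J2 N))"
    using mult_left_mono [OF bound [of 1], of J1] mult_left_mono [OF bound [of 2], of J2] assms(1,2)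
    by simp
  with assms(6) show False
    by (simp add: algebra_simps)
qed

end
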